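(* Let $V$ be a Banach space, let $\mathcal{A}$ be a Banach subalgebra of the algebra $L(V)$ of bounded operators on $V$ (with composition), and let $x\in V$, $\phi\in V^{*}$. Then: (1) If $\widehat{\mathcal{O}}_{\phi}^{(l)}\colon B_{V^{**}}\to\mathcal{A}^{*}$ is (weak-star, norm) fragmented, then $\Phi_{x,\phi}$ is right Asplund. (2) If $\widehat{\mathcal{O}}_{x}^{(r)}\colon B_{V^{*}}\to\mathcal{A}^{*}$ is (weak-star, norm) fragmented, then $\Phi_{x,\phi}$ is left Asplund. (3) If $\widehat{\mathcal{O}}_{\phi}^{(l)}(B_{V^{**}})$ is norm separable (resp. co-tame), then $\Phi_{x,\phi}$ is right Asplund (resp. right tame). (4) If $\widehat{\mathcal{O}}_{x}^{(r)}(B_{V^{*}})$ is norm separable (resp. co-tame), then $\Phi_{x,\phi}$ is left Asplund (resp. left tame).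
   Context: All vector spaces are over $\mathbb{R}$; $B_{W}$ is the closed unit ball of a Banach space $W$. For $\phi\in V^{*}$ and $a\in\mathcal{A}$, $\phi\cdot a\in V^{*}$ is $\langle\phi\cdot a,x\rangle:=\langle\phi,ax\rangle$. The matrix coefficient $\Phi_{x,\phi}\in\mathcal{A}^{*}$ is $\langle\Phi_{x,\phi},b\rangle:=\langle\phi,bx\rangle$. The maps $\widehat{\mathcal{O}}_{\phi}^{(l)}\colon V^{**}\to\mathcal{A}^{*}$ and $\widehat{\mathcal{O}}_{x}^{(r)}\colon V^{*}\to\mathcal{A}^{*}$ are defined by $\langle\widehat{\mathcal{O}}_{\phi}^{(l)}(\omega),b\rangle:=\langle\omega,\phi\cdot b\rangle$ and $\langle\widehat{\mathcal{O}}_{x}^{(r)}(\theta),b\rangle:=\langle\theta,bx\rangle$ for $b\in\mathcal{A}$, $\omega\in V^{**}$, $\theta\in V^{*}$. For $a,b\in\mathcal{A}$, $\varphi\in\mathcal{A}^{*}$: $\langle a\circledast\varphi,b\rangle:=\langle\varphi,ba\rangle$ and $\langle\varphi\circledast a,b\rangle:=\langle\varphi,ab\rangle$. A functional $\varphi\in\mathcal{A}^{*}$ is left (right) Asplund if $B_{\mathcal{A}}\circledast\varphi=\{a\circledast\varphi:a\in B_{\mathcal{A}}\}$ (respectively $\varphi\circledast B_{\mathcal{A}}=\{\varphi\circledast a:a\in B_{\mathcal{A}}\}$) is an Asplund subset of $\mathcal{A}^{*}$; left (right) tame is defined in the same way with "tame subset". Let $X$ be a topological space and $(M,d)$ a metric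 space. A map $f\colon X\to M$ is fragmented if for every nonempty $A\subseteq X$ and $\varepsilon>0$ there is an open $O\subseteq X$ with $O\cap A\neq\emptyset$ and $\mathrm{diam}_{d}f(O\cap A)<\varepsilon$; a family of maps is fragmented if a single $O$ can be chosen for all its members. "(weak-star, norm) fragmented" uses the weak-star topology on the domain and the norm metric on the target. A bounded subset $C$ of a Banach space $W$ is Asplund if it is a fragmented family of functions on $(B_{W^{*}},w^{*})$; it is tame if it contains no $\ell^{1}$-sequence, equivalently no sequence independent over $B_{W^{*}}$. Here a bounded sequence $\{f_{n}\}$ of real functions on a set $X$ is independent if there are reals $a<b$ such that for all finite disjoint $N,M\subseteq\mathbb{N}$ there is $x\in X$ with $f_{n}(x)\le a$ for $n\in N$ and $f_{m}(x)\ge b$ for $m\in M$. A weak-star compact $M\subseteq W^{*}$ is co-tame if $B_{W}$ is tame as a family of functions on $M$, i.e. contains no sequence independent over $M$. *)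

theory Defs
  imports "HOL-Analysis.Analysis"
begin

text \<open>
  The dual of a normed space \<open>'w\<close> is the type \<open>'w \<Rightarrow>\<^sub>L real\<close> with its operator norm; closed unit
  balls are \<open>cball 0 1\<close>. On a dual, the topology of pointwise convergence
  (\<open>strong_operator_topology\<close> with real values) is exactly the weak-star topology.
\<close>

abbreviation weak_star :: "('w::real_normed_vector \<Rightarrow>\<^sub>L real) topology" where
  "weak_star \<equiv> strong_operator_topology"

abbreviation weak_star_ball :: "('w::real_normed_vector \<Rightarrow>\<^sub>L real) topology" where
  "weak_star_ball \<equiv> subtopology weak_star (cball 0 1)"


section \<open>Fragmented maps and families\<close>

text \<open>
  Since \<open>diameter\<close> is only meaningful for bounded sets, a diameter below \<open>\<epsilon>\<close> is
  stated together with boundedness.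
\<close>

definition fragmented_family :: "'x topology \<Rightarrow> ('x \<Rightarrow> 'm::metric_space) set \<Rightarrow> bool" where
  "fragmented_family X F \<longleftrightarrow>
     (\<forall>A \<epsilon>. A \<subseteq> topspace X \<and> A \<noteq> {} \<and> 0 < \<epsilon> \<longrightarrow>
        (\<exists>U. openin X U \<and> U \<inter> A \<noteq> {} \<and>
             (\<forall>f\<in>F. bounded (f ` (U \<inter> A)) \<and> diameter (f ` (U \<inter> A)) < \<epsilon>)))"

definition fragmented :: "'x topology \<Rightarrow> ('x \<Rightarrow> 'm::metric_space) \<Rightarrow> bool" where
  "fragmented X f \<longleftrightarrow> fragmented_family X {f}"


section \<open>Asplund, tame and co-tame subsets\<close>

definition asplund_subset :: "'w::banach set \<Rightarrow> bool" where
  "asplund_subset C \<longleftrightarrow>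
     bounded C \<and> fragmented_family weak_star_ball ((\<lambda>w \<psi>. blinfun_apply \<psi> w) ` C)"

text \<open>
  A bounded sequence is an \<open>\<ell>\<^sup>1\<close>-sequence if it is equivalent to the unit vector basis of
  \<open>\<ell>\<^sup>1\<close>; the upper estimate follows from boundedness.
\<close>

definition l1_sequence :: "(nat \<Rightarrow> 'w::banach) \<Rightarrow> bool" where
  "l1_sequence f \<longleftrightarrow>
     bounded (range f) \<and>
     (\<exists>\<delta>>0. \<forall>n (c :: nat \<Rightarrow> real). \<delta> * (\<Sum>i<n. \<bar>c i\<bar>) \<le> norm (\<Sum>i<n. c i *\<^sub>R f i))"

definition tame_subset :: "'w::banach set \<Rightarrow> bool" where
  "tame_subset C \<longleftrightarrow> bounded C \<and> \<not> (\<exists>f. range f \<subseteq> C \<and> l1_sequence f)"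

definition independent_over :: "'x set \<Rightarrow> (nat \<Rightarrow> 'x \<Rightarrow> real) \<Rightarrow> bool" where
  "independent_over X f \<longleftrightarrow>
     (\<exists>K. \<forall>n. \<forall>x\<in>X. \<bar>f n x\<bar> \<le> K) \<and>
     (\<exists>a b. a < b \<and>
        (\<forall>N M. finite N \<and> finite M \<and> N \<inter> M = {} \<longrightarrow>
           (\<exists>x\<in>X. (\<forall>n\<in>N. f n x \<le> a) \<and> (\<forall>m\<in>M. b \<le> f m x))))"

definition co_tame :: "('w::banach \<Rightarrow>\<^sub>L real) set \<Rightarrow> bool" where
  "co_tame M \<longleftrightarrow>
     compactin weak_star M \<and>
     \<not> (\<exists>w :: nat \<Rightarrow> 'w. range w \<subseteq> cball 0 1 \<and>
          independent_over M (\<lambda>n \<psi>. blinfun_apply \<psi> (w n)))"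


section \<open>Functionals on a Banach algebra\<close>

text \<open>
  Functionals are introduced through \<open>Blinfun\<close>; the accompanying lemmas show that the functions
  involved are bounded linear, so that the defining formulas hold pointwise.
\<close>

definition left_circ :: "'a \<Rightarrow> ('a::real_normed_algebra \<Rightarrow>\<^sub>L real) \<Rightarrow> ('a \<Rightarrow>\<^sub>L real)" (infixr "\<circledast>\<^sub>l" 70)
  where "a \<circledast>\<^sub>l \<psi> = Blinfun (\<lambda>b. blinfun_apply \<psi> (b * a))"

lemma left_circ_apply: "blinfun_apply (a \<circledast>\<^sub>l \<psi>) b = blinfun_apply \<psi> (b * a)"
  unfolding left_circ_def
  by (subst bounded_linear_Blinfun_apply)
    (auto intro!: bounded_linear_compose[OF blinfun.bounded_linear_right] bounded_linear_mult_left)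

definition right_circ :: "('a::real_normed_algebra \<Rightarrow>\<^sub>L real) \<Rightarrow> 'a \<Rightarrow> ('a \<Rightarrow>\<^sub>L real)" (infixl "\<circledast>\<^sub>r" 70)
  where "\<psi> \<circledast>\<^sub>r a = Blinfun (\<lambda>b. blinfun_apply \<psi> (a * b))"

lemma right_circ_apply: "blinfun_apply (\<psi> \<circledast>\<^sub>r a) b = blinfun_apply \<psi> (a * b)"
  unfolding right_circ_def
  by (subst bounded_linear_Blinfun_apply)
    (auto intro!: bounded_linear_compose[OF blinfun.bounded_linear_right] bounded_linear_mult_right)

definition left_asplund :: "('a::{banach,real_normed_algebra} \<Rightarrow>\<^sub>L real) \<Rightarrow> bool" where
  "left_asplund \<psi> \<longleftrightarrow> asplund_subset ((\<lambda>a. a \<circledast>\<^sub>l \<psi>) ` cball 0 1)"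

definition right_asplund :: "('a::{banach,real_normed_algebra} \<Rightarrow>\<^sub>L real) \<Rightarrow> bool" where
  "right_asplund \<psi> \<longleftrightarrow> asplund_subset ((\<lambda>a. \<psi> \<circledast>\<^sub>r a) ` cball 0 1)"

definition left_tame :: "('a::{banach,real_normed_algebra} \<Rightarrow>\<^sub>L real) \<Rightarrow> bool" where
  "left_tame \<psi> \<longleftrightarrow> tame_subset ((\<lambda>a. a \<circledast>\<^sub>l \<psi>) ` cball 0 1)"

definition right_tame :: "('a::{banach,real_normed_algebra} \<Rightarrow>\<^sub>L real) \<Rightarrow> bool" where
  "right_tame \<psi> \<longleftrightarrow> tame_subset ((\<lambda>a. \<psi> \<circledast>\<^sub>r a) ` cball 0 1)"


section \<open>Banach subalgebras of the bounded operators\<close>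

text \<open>
  A Banach subalgebra of \<open>L(V)\<close> (closed, with the operator norm, not assumed unital) is given by
  its inclusion: a type \<open>'a\<close> for the subalgebra as a Banach space in its own right, so that its
  dual is \<open>'a \<Rightarrow>\<^sub>L real\<close>, and an isometric, multiplicative bounded linear map
  \<open>\<iota> :: 'a \<Rightarrow>\<^sub>L ('v \<Rightarrow>\<^sub>L 'v)\<close>. Completeness of \<open>'a\<close> makes the range closed, see
  \<open>banach_subalgebra_range\<close> below.
\<close>

definition banach_subalgebra ::
  "('a::{banach,real_normed_algebra} \<Rightarrow>\<^sub>L ('v::banach \<Rightarrow>\<^sub>L 'v)) \<Rightarrow> bool" where
  "banach_subalgebra \<iota> \<longleftrightarrow>
     (\<forall>a. norm (blinfun_apply \<iota> a) = norm a) \<and>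
     (\<forall>a b. blinfun_apply \<iota> (a * b) = blinfun_apply \<iota> a o\<^sub>L blinfun_apply \<iota> b)"

lemma banach_subalgebra_range:
  assumes "banach_subalgebra \<iota>"
  shows "subspace (range (blinfun_apply \<iota>))"
    and "closed (range (blinfun_apply \<iota>))"
    and "S \<in> range (blinfun_apply \<iota>) \<Longrightarrow> T \<in> range (blinfun_apply \<iota>) \<Longrightarrow>
           S o\<^sub>L T \<in> range (blinfun_apply \<iota>)"
    and "inj (blinfun_apply \<iota>)"
proof -
  have iso: "\<And>a. norm (blinfun_apply \<iota> a) = norm a"
    and mult: "\<And>a b. blinfun_apply \<iota> (a * b) = blinfun_apply \<iota> a o\<^sub>L blinfun_apply \<iota> b"
    using assms by (auto simp: banach_subalgebra_def)
  show "subspace (range (blinfun_apply \<iota>))"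
    by (intro linear_subspace_image bounded_linear.linear blinfun.bounded_linear_right subspace_UNIV)
  have "complete (range (blinfun_apply \<iota>))"
    by (rule complete_isometric_image[where e = 1])
      (auto simp: iso complete_UNIV intro: blinfun.bounded_linear_right)
  then show "closed (range (blinfun_apply \<iota>))"
    by (rule complete_imp_closed)
  show "S o\<^sub>L T \<in> range (blinfun_apply \<iota>)"
    if "S \<in> range (blinfun_apply \<iota>)" "T \<in> range (blinfun_apply \<iota>)"
    using that by (auto simp: mult[symmetric])
  show "inj (blinfun_apply \<iota>)"
  proof (rule injI)
    fix a b
    assume "blinfun_apply \<iota> a = blinfun_apply \<iota> b"
    then have "norm (a - b) = 0"
      by (simp add: iso[symmetric] blinfun.diff_right)
    then show "a = b"
      by simp
  qed
qed

definition functional_act ::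
  "('a::real_normed_vector \<Rightarrow>\<^sub>L ('v::real_normed_vector \<Rightarrow>\<^sub>L 'v)) \<Rightarrow> ('v \<Rightarrow>\<^sub>L real) \<Rightarrow> 'a \<Rightarrow> ('v \<Rightarrow>\<^sub>L real)"
  where "functional_act \<iota> \<phi> a = \<phi> o\<^sub>L blinfun_apply \<iota> a"

definition matrix_coefficient ::
  "('a::real_normed_vector \<Rightarrow>\<^sub>L ('v::real_normed_vector \<Rightarrow>\<^sub>L 'v)) \<Rightarrow> 'v \<Rightarrow> ('v \<Rightarrow>\<^sub>L real) \<Rightarrow> ('a \<Rightarrow>\<^sub>L real)"
  where "matrix_coefficient \<iota> x \<phi> = Blinfun (\<lambda>b. blinfun_apply \<phi> (blinfun_apply (blinfun_apply \<iota> b) x))"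

lemma bounded_linear_coefficient:
  "bounded_linear (\<lambda>b. blinfun_apply \<phi> (blinfun_apply (blinfun_apply \<iota> b) x))"
  by (intro bounded_linear_compose[OF blinfun.bounded_linear_right, of _ \<phi>]
        bounded_linear_compose[OF blinfun.bounded_linear_left, of _ x] blinfun.bounded_linear_right)

lemma matrix_coefficient_apply:
  "blinfun_apply (matrix_coefficient \<iota> x \<phi>) b = blinfun_apply \<phi> (blinfun_apply (blinfun_apply \<iota> b) x)"
  by (simp add: matrix_coefficient_def bounded_linear_Blinfun_apply bounded_linear_coefficient)

definition orbit_left ::
  "('a::real_normed_vector \<Rightarrow>\<^sub>L ('v::real_normed_vector \<Rightarrow>\<^sub>L 'v)) \<Rightarrow> ('v \<Rightarrow>\<^sub>L real) \<Rightarrow>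
     (('v \<Rightarrow>\<^sub>L real) \<Rightarrow>\<^sub>L real) \<Rightarrow> ('a \<Rightarrow>\<^sub>L real)"
  where "orbit_left \<iota> \<phi> \<omega> = Blinfun (\<lambda>b. blinfun_apply \<omega> (functional_act \<iota> \<phi> b))"

lemma orbit_left_apply:
  "blinfun_apply (orbit_left \<iota> \<phi> \<omega>) b = blinfun_apply \<omega> (functional_act \<iota> \<phi> b)"
proof -
  have "bounded_linear (functional_act \<iota> \<phi>)"
    unfolding functional_act_def
    by (rule bounded_linear_compose[OF
          bounded_bilinear.bounded_linear_right[OF bounded_bilinear_blinfun_compose]
          blinfun.bounded_linear_right])
  then have "bounded_linear (\<lambda>b. blinfun_apply \<omega> (functional_act \<iota> \<phi> b))"
    by (rule bounded_linear_compose[OF blinfun.bounded_linear_right])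
  then show ?thesis
    by (simp add: orbit_left_def bounded_linear_Blinfun_apply)
qed

definition orbit_right ::
  "('a::real_normed_vector \<Rightarrow>\<^sub>L ('v::real_normed_vector \<Rightarrow>\<^sub>L 'v)) \<Rightarrow> 'v \<Rightarrow> ('v \<Rightarrow>\<^sub>L real) \<Rightarrow> ('a \<Rightarrow>\<^sub>L real)"
  where "orbit_right \<iota> x \<theta> = Blinfun (\<lambda>b. blinfun_apply \<theta> (blinfun_apply (blinfun_apply \<iota> b) x))"

lemma orbit_right_apply:
  "blinfun_apply (orbit_right \<iota> x \<theta>) b = blinfun_apply \<theta> (blinfun_apply (blinfun_apply \<iota> b) x)"
  by (simp add: orbit_right_def bounded_linear_Blinfun_apply bounded_linear_coefficient)

end

theory Submission
  imports Defs
begin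

text \<open>
  The orbit \<open>a \<mapsto> \<Phi> \<circledast> a\<close> of \<open>\<Phi> = \<Phi>\<^bsub>x,\<phi>\<^esub>\<close> factors as \<open>S \<circ> R\<close> through \<open>V\<^sup>*\<close> via
  \<open>a \<mapsto> \<phi> \<cdot> a \<mapsto> (b \<mapsto> \<langle>\<phi> \<cdot> a, b x\<rangle>)\<close>, and \<open>a \<mapsto> a \<circledast> \<Phi>\<close> factors through \<open>V\<close> via
  \<open>a \<mapsto> a x \<mapsto> (b \<mapsto> \<langle>\<phi>, b (a x)\<rangle>)\<close>; the orbit maps of the hypotheses are the dual operators of
  the two maps \<open>R\<close>. A functional \<open>\<psi>\<close> evaluated along the orbit is thus the orbit map at
  \<open>\<psi> \<circ> S\<close>, which is weak-star continuous in \<open>\<psi>\<close> and bounded by \<open>\<parallel>S\<parallel>\<close>, so fragmentability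
  transfers. Norm separability implies fragmentability by the Baire category theorem on weak-star
  compact sets. An \<open>\<ell>\<^sup>1\<close>-sequence in the orbit admits, by Hahn-Banach, functionals in the unit
  ball with arbitrary values \<open>\<plusminus>\<delta>\<close> on it, hence is independent and contradicts co-tameness.
\<close>

section \<open>The Hahn-Banach theorem\<close>

text \<open>Using the scaling inequality for \<open>1/t\<close> as well turns it into positive
  homogeneity; the one-sided form is easier to verify for infima.\<close>

definition sublinear :: "('e::real_vector \<Rightarrow> real) \<Rightarrow> bool" where
  "sublinear p \<longleftrightarrow> (\<forall>x y. p (x + y) \<le> p x + p y) \<and> (\<forall>t>0. \<forall>x. p (t *\<^sub>R x) \<le> t * p x)"

lemma sublinear_add: "sublinear p \<Longrightarrow> p (x + y) \<le> p x + p y"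
  by (simp add: sublinear_def)

lemma sublinear_scaleR_le: "sublinear p \<Longrightarrow> 0 < t \<Longrightarrow> p (t *\<^sub>R x) \<le> t * p x"
  by (simp add: sublinear_def)

lemma sublinear_zero:
  assumes "sublinear p"
  shows "p 0 = 0"
  using sublinear_add[OF assms, of 0 0] sublinear_scaleR_le[OF assms, of "1/2" 0] by simp

lemma sublinear_minus:
  assumes "sublinear p"
  shows "- p (- x) \<le> p x"
  using sublinear_add[OF assms, of x "- x"] sublinear_zero[OF assms] by simp

text \<open>The free choice of \<open>k\<close> covers two situations: in a chain of functionals the
  smaller member serves, and in an index set closed under sums and positive multiples the combined
  index serves.\<close>

lemma sublinear_INF:
  assumes "C \<noteq> {}"
    and "\<And>x. bdd_below ((\<lambda>i. F i x) ` C)"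
    and add: "\<And>i j x y. i \<in> C \<Longrightarrow> j \<in> C \<Longrightarrow> \<exists>k\<in>C. F k (x + y) \<le> F i x + F j y"
    and scale: "\<And>i t x. i \<in> C \<Longrightarrow> 0 < t \<Longrightarrow> \<exists>k\<in>C. F k (t *\<^sub>R x) \<le> t * F i x"
  shows "sublinear (\<lambda>x. INF i\<in>C. F i x)"
  unfolding sublinear_def
proof (intro conjI allI impI)
  let ?u = "\<lambda>x. INF i\<in>C. F i x"
  have lower: "?u x \<le> F i x" if "i \<in> C" for i x
    using assms(2) that by (rule cINF_lower)
  fix x y
  have *: "?u (x + y) \<le> F i x + F j y" if "i \<in> C" "j \<in> C" for i j
    using add[OF that, of x y] lower order_trans by blast
  \<comment> \<open>The infimum is taken over \<open>i\<close> with \<open>j\<close> fixed, and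
    afterwards over \<open>j\<close>.\<close>
  have "?u (x + y) - F j y \<le> ?u x" if "j \<in> C" for j
    using * that by (intro cINF_greatest[OF assms(1)]) (simp add: algebra_simps)
  then have "?u (x + y) - ?u x \<le> ?u y"
    by (intro cINF_greatest[OF assms(1)]) (simp add: algebra_simps)
  then show "?u (x + y) \<le> ?u x + ?u y"
    by simp
next
  let ?u = "\<lambda>x. INF i\<in>C. F i x"
  fix t :: real and x
  assume t: "0 < t"
  have "?u (t *\<^sub>R x) \<le> t * F i x" if "i \<in> C" for i
    using scale[OF that t, of x] cINF_lower[OF assms(2)] order_trans by blast
  then have "?u (t *\<^sub>R x) / t \<le> ?u x"
    using t by (intro cINF_greatest[OF assms(1)]) (simp add: field_simps)
  then show "?u (t *\<^sub>R x) \<le> t * ?u x"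
    using t by (simp add: field_simps)
qed

text \<open>
  A minimal sublinear functional \<open>m\<close> is linear: for fixed \<open>y\<close>, the infimum over \<open>t \<ge> 0\<close> of
  \<open>m (x + t y) - t m y\<close> is again sublinear and below \<open>m\<close>, hence equal to \<open>m\<close>.
\<close>

lemma minimal_sublinear_linear:
  assumes m: "sublinear m"
    and min: "\<And>q. sublinear q \<Longrightarrow> q \<le> m \<Longrightarrow> q = m"
  shows "linear m"
proof -
  have super: "m x + m y \<le> m (x + y)" for x y
  proof -
    define F where "F = (\<lambda>t x. m (x + t *\<^sub>R y) - t * m y)"
    define u where "u = (\<lambda>x. INF t\<in>{0..}. F t x)"
    \<comment> \<open>A bound free of \<open>t\<close> keeps the infimum defining \<open>u\<close>
      finite.\<close>
    have lb: "- m (- z) \<le> F t z" if "0 \<le> t" for t z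
    proof -
      have "m (t *\<^sub>R y) \<le> m (z + t *\<^sub>R y) + m (- z)"
        using sublinear_add[OF m, of "z + t *\<^sub>R y" "- z"] by simp
      moreover have "t * m y \<le> m (t *\<^sub>R y)"
      proof (cases "t = 0")
        case False
        with that have "m ((1/t) *\<^sub>R (t *\<^sub>R y)) \<le> (1/t) * m (t *\<^sub>R y)"
          by (intro sublinear_scaleR_le m) simp
        with False that show ?thesis
          by (simp add: field_simps)
      qed (simp add: sublinear_zero[OF m])
      ultimately show ?thesis
        by (simp add: F_def)
    qed
    have bdd: "bdd_below ((\<lambda>t. F t z) ` {0..})" for z
      using lb by (intro bdd_belowI2) auto
    have "sublinear u"
      unfolding u_def
    proof (rule sublinear_INF[OF _ bdd])
      fix s t :: real and z w
      assume "s \<in> {0..}" "t \<in> {0..}"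
      moreover have "F (s + t) (z + w) \<le> F s z + F t w"
        using sublinear_add[OF m, of "z + s *\<^sub>R y" "w + t *\<^sub>R y"]
        by (simp add: F_def algebra_simps)
      ultimately show "\<exists>k\<in>{0..}. F k (z + w) \<le> F s z + F t w"
        by (intro bexI[of _ "s + t"]) auto
    next
      fix s t :: real and z
      assume "s \<in> {0..}" "0 < t"
      moreover from \<open>0 < t\<close> have "F (t * s) (t *\<^sub>R z) \<le> t * F s z"
        using sublinear_scaleR_le[OF m, of t "z + s *\<^sub>R y"]
        by (simp add: F_def algebra_simps)
      ultimately show "\<exists>k\<in>{0..}. F k (t *\<^sub>R z) \<le> t * F s z"
        by (intro bexI[of _ "t * s"]) auto
    qed simp
    \<comment> \<open>The index \<open>t = 0\<close> gives \<open>u \<le> m\<close>, so minimality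
      forces equality; the index \<open>t = 1\<close> then reads
      \<open>m x \<le> m (x + y) - m y\<close>.\<close>
    moreover have "u z \<le> m z" for z
      using cINF_lower[OF bdd, of 0 z] by (simp add: u_def F_def)
    ultimately have "u = m"
      by (intro min) (auto simp: le_fun_def)
    moreover have "u x \<le> F 1 x"
      unfolding u_def by (rule cINF_lower[OF bdd]) simp
    ultimately show ?thesis
      by (simp add: F_def)
  qed
  have add: "m (x + y) = m x + m y" for x y
    using super sublinear_add[OF m] by (rule antisym[rotated])
  have neg: "m (- x) = - m x" for x
    using add[of x "- x"] sublinear_zero[OF m] by simp
  have pos: "m (t *\<^sub>R x) = t * m x" if "0 < t" for t x
    using sublinear_scaleR_le[OF m that, of x] sublinear_scaleR_le[OF m that, of "- x"]
    by (simp add: neg)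
  have "m (t *\<^sub>R x) = t * m x" for t x
  proof (cases t "0::real" rule: linorder_cases)
    case less
    then show ?thesis
      using pos[of "- t" x] neg[of "t *\<^sub>R x"] by simp
  qed (simp_all add: pos sublinear_zero[OF m])
  with add show ?thesis
    by (intro linearI) auto
qed

text \<open>Zorn's lemma yields a minimal sublinear functional below \<open>p\<close>, and minimal
  ones are linear.\<close>

theorem sublinear_dominates_linear:
  assumes p: "sublinear p"
  obtains g where "linear g" "\<And>x. g x \<le> p x"
proof -
  let ?A = "{q. sublinear q \<and> q \<le> p}"
  have "\<exists>m\<in>?A. \<forall>q\<in>?A. q \<le> m \<longrightarrow> q = m"
  \<comment> \<open>The order is reversed, so that a maximal element is a minimal
    functional.\<close>
  proof (rule predicate_Zorn[where P = "\<lambda>q r. r \<le> q"])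
    show "partial_order_on ?A (relation_of (\<lambda>q r. r \<le> q) ?A)"
      by (rule partial_order_on_relation_ofI) auto
  next
    fix C
    assume C: "C \<in> Chains (relation_of (\<lambda>q r. r \<le> q) ?A)"
    then have sub: "sublinear q" "q \<le> p" if "q \<in> C" for q
      using that by (auto simp: Chains_def relation_of_def)
    have chain: "q \<le> r \<or> r \<le> q" if "q \<in> C" "r \<in> C" for q r
      using C that by (auto simp: Chains_def relation_of_def)
    show "\<exists>u\<in>?A. \<forall>q\<in>C. u \<le> q"
    proof (cases "C = {}")
      case True
      with p show ?thesis by auto
    next
      case False
      define u where "u = (\<lambda>x. INF q\<in>C. q x)"
      \<comment> \<open>All members of the chain share this lower bound, so their pointwise infimum
        is finite.\<close>
      have "- p (- x) \<le> q x" if "q \<in> C" for q x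
        using sublinear_minus[OF sub(1)[OF that], of x] le_funD[OF sub(2)[OF that], of "- x"]
        by simp
      then have bdd: "bdd_below ((\<lambda>q. q x) ` C)" for x
        by (intro bdd_belowI2)
      have "sublinear u"
        unfolding u_def
      proof (rule sublinear_INF[OF False bdd])
        fix q r x y
        assume qr: "q \<in> C" "r \<in> C"
        from chain[OF qr] show "\<exists>k\<in>C. k (x + y) \<le> q x + r y"
        proof
          assume "q \<le> r"
          then have "q (x + y) \<le> q x + r y"
            using sublinear_add[OF sub(1)[OF qr(1)], of x y] le_funD[of q r y] by simp
          with qr show ?thesis by blast
        next
          assume "r \<le> q"
          then have "r (x + y) \<le> q x + r y"
            using sublinear_add[OF sub(1)[OF qr(2)], of x y] le_funD[of r q x] by simp
          with qr show ?thesis by blast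
        qed
      qed (use sub sublinear_scaleR_le in blast)
      moreover have lower: "u \<le> q" if "q \<in> C" for q
        unfolding u_def using that by (intro le_funI cINF_lower[OF bdd])
      moreover from False have "u \<le> p"
        using lower sub(2) order_trans by blast
      ultimately show ?thesis by blast
    qed
  qed
  then obtain m where m: "sublinear m" "m \<le> p"
    and min: "\<And>q. sublinear q \<Longrightarrow> q \<le> p \<Longrightarrow> q \<le> m \<Longrightarrow> q = m"
    by blast
  have "linear m"
    using m min by (intro minimal_sublinear_linear) (auto intro: order_trans)
  with m show ?thesis
    by (intro that) (auto simp: le_fun_def)
qed

text \<open>The functional to be extended is given by its graph \<open>G\<close>.\<close>

theorem hahn_banach_graph:
  fixes G :: "('e::real_normed_vector \<times> real) set"
  assumes G: "subspace G" and le: "\<And>u r. (u, r) \<in> G \<Longrightarrow> r \<le> norm u"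
  obtains \<psi> :: "'e \<Rightarrow>\<^sub>L real"
  where "norm \<psi> \<le> 1" "\<And>u r. (u, r) \<in> G \<Longrightarrow> blinfun_apply \<psi> u = r"
proof -
  \<comment> \<open>The infimum \<open>p\<close> of these functions is made so that any linear
    \<open>g \<le> p\<close> is the desired extension: the index \<open>(0, 0)\<close> gives the
    norm bound, while \<open>(u, r)\<close> at \<open>u\<close> and \<open>(- u, - r)\<close> at
    \<open>- u\<close> give \<open>g u = r\<close>.\<close>
  define F where "F = (\<lambda>(u, r) (x::'e). norm (x - u) + r :: real)"
  define p where "p = (\<lambda>x. INF z\<in>G. F z x)"
  have G0: "(0, 0) \<in> G"
    using subspace_0[OF G] by (simp add: zero_prod_def)
  have Gneg: "(- u, - r) \<in> G" if "(u, r) \<in> G" for u r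
    using subspace_scale[OF G that, of "-1"] by simp
  have "- norm x \<le> F z x" if "z \<in> G" for z x
  proof -
    obtain u r where z: "z = (u, r)" by force
    with that have "- r \<le> norm u"
      using le[OF Gneg] by simp
    then show ?thesis
      using norm_triangle_ineq2[of u x] by (simp add: F_def z norm_minus_commute)
  qed
  then have bdd: "bdd_below ((\<lambda>z. F z x) ` G)" for x
    by (intro bdd_belowI2)
  have lower: "p x \<le> norm (x - u) + r" if "(u, r) \<in> G" for x u r
    using cINF_lower[OF bdd that, of x] by (simp add: p_def F_def)
  have "sublinear p"
    unfolding p_def
  proof (rule sublinear_INF[OF _ bdd])
    show "G \<noteq> {}" using G0 by blast
  next
    fix z w x y
    assume zw: "z \<in> G" "w \<in> G"
    obtain u r v s where eq: "z = (u, r)" "w = (v, s)" by (metis surj_pair)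
    have "norm (x + y - (u + v)) \<le> norm (x - u) + norm (y - v)"
      by (rule norm_diff_triangle_ineq)
    then have "F (z + w) (x + y) \<le> F z x + F w y"
      by (simp add: F_def eq)
    then show "\<exists>k\<in>G. F k (x + y) \<le> F z x + F w y"
      using subspace_add[OF G zw] by blast
  next
    fix z t x
    assume z: "z \<in> G" and t: "(0::real) < t"
    obtain u r where eq: "z = (u, r)" by force
    have "norm (t *\<^sub>R x - t *\<^sub>R u) = t * norm (x - u)"
      using t by (simp flip: scaleR_diff_right)
    then have "F (t *\<^sub>R z) (t *\<^sub>R x) \<le> t * F z x"
      by (simp add: F_def eq algebra_simps)
    then show "\<exists>k\<in>G. F k (t *\<^sub>R x) \<le> t * F z x"
      using subspace_scale[OF G z] by blast
  qed
  then obtain g where g: "linear g" "\<And>x. g x \<le> p x"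
    by (rule sublinear_dominates_linear) blast
  have g_le: "g x \<le> norm x" for x
    using g(2)[of x] lower[OF G0, of x] by simp
  have g_abs: "\<bar>g x\<bar> \<le> norm x" for x
    using g_le[of x] g_le[of "- x"] by (simp add: linear_neg[OF g(1)] abs_le_iff)
  have bl: "bounded_linear g"
    using g(1) g_abs
    by (intro bounded_linear_intro[of g 1]) (auto simp: linear_add linear_scale)
  have ap: "blinfun_apply (Blinfun g) = g"
    by (simp add: bounded_linear_Blinfun_apply[OF bl])
  show ?thesis
  proof (rule that[of "Blinfun g"])
    show "norm (Blinfun g) \<le> 1"
      using g_abs by (intro norm_blinfun_bound) (auto simp: ap)
    fix u r
    assume ur: "(u, r) \<in> G"
    have "g u \<le> r"
      using g(2)[of u] lower[OF ur, of u] by simp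
    moreover have "g (- u) \<le> - r"
      using g(2)[of "- u"] lower[OF Gneg[OF ur], of "- u"] by simp
    ultimately show "blinfun_apply (Blinfun g) u = r"
      by (simp add: ap linear_neg[OF g(1)])
  qed
qed

section \<open>Interpolation on l1-sequences\<close>

lemma span_range_nat_sum:
  fixes g :: "nat \<Rightarrow> 'e::real_vector"
  assumes "z \<in> span (range g)"
  shows "\<exists>n c. z = (\<Sum>i<n. c i *\<^sub>R g i)"
  using assms
proof (induction rule: span_induct_alt)
  case base
  show ?case by (intro exI[of _ 0]) simp
next
  case (step a u v)
  then obtain j n c where j: "u = g j" and v: "v = (\<Sum>i<n. c i *\<^sub>R g i)"
    by blast
  \<comment> \<open>Both sums are padded with zero coefficients to a common length;
    \<open>Suc j\<close> places the index \<open>j\<close> inside the range.\<close>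
  define N where "N = max n (Suc j)"
  have "v = (\<Sum>i<N. (if i < n then c i else 0) *\<^sub>R g i)"
    unfolding v by (rule sum.mono_neutral_cong_left) (auto simp: N_def)
  moreover have "a *\<^sub>R u = (\<Sum>i<N. (if i = j then a else 0) *\<^sub>R g i)"
    unfolding j by (subst sum.mono_neutral_right[of _ "{j}"]) (auto simp: N_def)
  ultimately have "a *\<^sub>R u + v =
      (\<Sum>i<N. ((if i = j then a else 0) + (if i < n then c i else 0)) *\<^sub>R g i)"
    by (simp add: scaleR_add_left sum.distrib)
  then show ?case by (intro exI)
qed

text \<open>On the span of the pairs \<open>(f i, s i)\<close> the second entry is at most
  \<open>\<delta>\<close> times the sum of the absolute coefficients, hence at most the norm of the
  first. The graph form of Hahn-Banach then applies; that the span is the graph of a function is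
  contained in this estimate.\<close>

lemma l1_sequence_interpolation:
  fixes f :: "nat \<Rightarrow> 'e::real_normed_vector"
  assumes d: "\<And>n (c :: nat \<Rightarrow> real).
      \<delta> * (\<Sum>i<n. \<bar>c i\<bar>) \<le> norm (\<Sum>i<n. c i *\<^sub>R f i)"
    and s: "\<And>i. \<bar>s i\<bar> \<le> \<delta>"
  obtains \<psi> :: "'e \<Rightarrow>\<^sub>L real" where "norm \<psi> \<le> 1" "\<And>i. blinfun_apply \<psi> (f i) = s i"
proof -
  let ?g = "\<lambda>i. (f i, s i)"
  have le: "r \<le> norm u" if ur: "(u, r) \<in> span (range ?g)" for u r
  proof -
    obtain n c where nc: "(u, r) = (\<Sum>i<n. c i *\<^sub>R ?g i)"
      using span_range_nat_sum[OF ur] by blast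
    have u: "u = (\<Sum>i<n. c i *\<^sub>R f i)" and r: "r = (\<Sum>i<n. c i * s i)"
      using arg_cong[OF nc, of fst] arg_cong[OF nc, of snd] by (simp_all add: fst_sum snd_sum)
    have "c i * s i \<le> \<delta> * \<bar>c i\<bar>" for i
    proof -
      have "c i * s i \<le> \<bar>c i\<bar> * \<bar>s i\<bar>"
        by (simp flip: abs_mult)
      also have "\<dots> \<le> \<bar>c i\<bar> * \<delta>"
        by (intro mult_left_mono s) simp
      finally show ?thesis by (simp add: mult.commute)
    qed
    then have "r \<le> \<delta> * (\<Sum>i<n. \<bar>c i\<bar>)"
      unfolding r sum_distrib_left by (intro sum_mono)
    also have "\<dots> \<le> norm u"
      unfolding u by (rule d)
    finally show ?thesis .
  qed
  show thesis
  proof (rule hahn_banach_graph[OF subspace_span le])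
    fix \<psi> :: "'e \<Rightarrow>\<^sub>L real"
    assume "norm \<psi> \<le> 1"
      and \<psi>: "\<And>u r. (u, r) \<in> span (range ?g) \<Longrightarrow> blinfun_apply \<psi> u = r"
    show thesis
      using \<open>norm \<psi> \<le> 1\<close> by (rule that) (auto intro!: \<psi> span_base)
  qed
qed


section \<open>The weak-star topology on the dual ball\<close>

lemma topspace_weak_star_ball: "topspace weak_star_ball = cball 0 1"
  by (simp add: strong_operator_topology_topspace)

lemma continuous_map_weak_star_ball_eval:
  "continuous_map weak_star_ball euclideanreal (\<lambda>\<psi>. blinfun_apply \<psi> w)"
  by (rule continuous_map_from_subtopology) (rule strong_operator_topology_continuous_evaluation)

text \<open>By Tychonoff's theorem the product \<open>P\<close> of the intervals
  \<open>cball 0 (norm w)\<close> is compact. The linear functions in it form a closed subset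
  \<open>L\<close>, which \<open>Blinfun\<close> maps continuously onto the dual ball.\<close>

theorem banach_alaoglu:
  "compact_space (weak_star_ball :: ('a::real_normed_vector \<Rightarrow>\<^sub>L real) topology)"
proof -
  define P where "P = PiE UNIV (\<lambda>w::'a. cball 0 (norm w) :: real set)"
  define L where "L = P \<inter> {g. linear g}"
  have "compactin euclidean P"
    unfolding P_def by (subst euclidean_product_topology[symmetric]) (simp add: compactin_PiE)
  moreover have "closed {g::'a \<Rightarrow> real. linear g}"
  proof -
    have "{g::'a \<Rightarrow> real. linear g} =
        {g. \<forall>x y. g (x + y) = g x + g y} \<inter> {g. \<forall>t x. g (t *\<^sub>R x) = t * g x}"
      by (auto simp: linear_iff)
    \<comment> \<open>Each equation involves finitely many coordinates, and these are continuous on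
      the product.\<close>
    moreover have "closed \<dots>"
      by (intro closed_Int closed_Collect_all closed_Collect_eq continuous_intros
          continuous_on_product_coordinates)
    ultimately show ?thesis by simp
  qed
  ultimately have L: "compactin euclidean L"
    unfolding L_def by (simp add: compact_Int_closed)
  have ap: "blinfun_apply (Blinfun g) = g" and L_le: "\<bar>g w\<bar> \<le> norm w" if "g \<in> L" for g w
  proof -
    from that have "linear g" and le: "\<And>w. \<bar>g w\<bar> \<le> norm w"
      by (auto simp: L_def P_def PiE_def Pi_def)
    then have "bounded_linear g"
      by (intro bounded_linear_intro[of g 1]) (auto simp: linear_add linear_scale)
    then show "blinfun_apply (Blinfun g) = g" "\<bar>g w\<bar> \<le> norm w"
      using le by (simp_all add: bounded_linear_Blinfun_apply)
  qed
  have "continuous_map (top_of_set L) weak_star Blinfun"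
    unfolding continuous_on_strong_operator_topo_iff_coordinatewise
  proof
    fix w
    have "continuous_on L (\<lambda>g. g w)"
      by (rule continuous_on_subset[OF continuous_on_product_coordinates]) simp
    then show "continuous_map (top_of_set L) euclidean (\<lambda>g. blinfun_apply (Blinfun g) w)"
      by (simp add: ap cong: continuous_on_cong)
  qed
  moreover have "Blinfun ` L = (cball 0 1 :: ('a \<Rightarrow>\<^sub>L real) set)"
  proof (intro equalityI subsetI)
    fix \<psi> :: "'a \<Rightarrow>\<^sub>L real"
    assume "\<psi> \<in> cball 0 1"
    then have "\<bar>blinfun_apply \<psi> w\<bar> \<le> norm w" for w
      using norm_blinfun[of \<psi> w] mult_right_mono[of "norm \<psi>" 1 "norm w"] by simp
    then have "blinfun_apply \<psi> \<in> L"
      by (auto simp: L_def P_def PiE_def intro!: bounded_linear.linear blinfun.bounded_linear_right)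
    then show "\<psi> \<in> Blinfun ` L"
      by (metis blinfun_apply_inverse imageI)
  next
    fix \<psi> :: "'a \<Rightarrow>\<^sub>L real"
    assume "\<psi> \<in> Blinfun ` L"
    then obtain g where "g \<in> L" "\<psi> = Blinfun g" by blast
    then show "\<psi> \<in> cball 0 1"
      using L_le by (simp add: norm_blinfun_bound ap)
  qed
  ultimately have "compactin weak_star (cball 0 1 :: ('a \<Rightarrow>\<^sub>L real) set)"
    using L image_compactin[of "top_of_set L" L weak_star Blinfun]
    by (simp add: compactin_subtopology)
  then show ?thesis
    by (rule compact_space_subtopology)
qed

text \<open>Distinct functionals are separated by evaluation at a single vector. Together with
  compactness this supplies the regularity for the Baire argument.\<close>

lemma Hausdorff_weak_star: "Hausdorff_space weak_star"
proof (unfold Hausdorff_space_def, intro allI impI)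
  fix \<psi> \<theta> :: "'a \<Rightarrow>\<^sub>L real"
  assume "\<psi> \<in> topspace weak_star \<and> \<theta> \<in> topspace weak_star \<and> \<psi> \<noteq> \<theta>"
  then obtain w where "blinfun_apply \<psi> w \<noteq> blinfun_apply \<theta> w"
    using blinfun_eqI by blast
  then obtain U V where UV: "open U" "open V" "blinfun_apply \<psi> w \<in> U" "blinfun_apply \<theta> w \<in> V"
    "U \<inter> V = {}"
    by (metis hausdorff)
  have "openin weak_star {\<psi>. blinfun_apply \<psi> w \<in> S}" if "open S" for S
    using openin_continuous_map_preimage[OF strong_operator_topology_continuous_evaluation, of S w] that
    by (simp add: strong_operator_topology_topspace)
  with UV show "\<exists>U V. openin weak_star U \<and> openin weak_star V \<and> \<psi> \<in> U \<and> \<theta> \<in> V \<and> disjnt U V"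
    by (intro exI[of _ "{\<psi>. blinfun_apply \<psi> w \<in> U}"] exI[of _ "{\<psi>. blinfun_apply \<psi> w \<in> V}"])
      (auto simp: disjnt_def)
qed


section \<open>Adjoint operators and the orbit maps\<close>

abbreviation dual_op ::
  "('a::real_normed_vector \<Rightarrow>\<^sub>L 'w::real_normed_vector) \<Rightarrow> ('w \<Rightarrow>\<^sub>L real) \<Rightarrow> ('a \<Rightarrow>\<^sub>L real)"
  where "dual_op R \<equiv> \<lambda>\<omega>. \<omega> o\<^sub>L R"

section \<open>Asplund and tame images of the unit ball under \<open>S \<circ> R\<close>\<close>

text \<open>Evaluation of \<open>\<psi>\<close> at \<open>S (R a)\<close> is evaluation at
  \<open>a\<close> of the dual operator of \<open>R\<close> applied to
  \<open>\<psi> \<circ> S\<close>. A norm estimate there is uniform over \<open>a\<close> in the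
  unit ball, so a single open set serves the whole family.\<close>

lemma asplund_subset_if_dual_op_fragmented:
  fixes R :: "'a::real_normed_vector \<Rightarrow>\<^sub>L 'w::real_normed_vector"
    and S :: "'w \<Rightarrow>\<^sub>L 'e::banach"
  assumes frag: "fragmented weak_star_ball (dual_op R)"
  shows "asplund_subset ((\<lambda>a. blinfun_apply S (blinfun_apply R a)) ` cball 0 1)"
  unfolding asplund_subset_def
proof
  let ?C = "(\<lambda>a. blinfun_apply S (blinfun_apply R a)) ` cball 0 1"
  show "bounded ?C"
    using bounded_linear_image[OF bounded_cball, of "\<lambda>a. blinfun_apply S (blinfun_apply R a)" 0 1]
    by (simp add: bounded_linear_compose blinfun.bounded_linear_right)
  \<comment> \<open>The summand 1 keeps \<open>K\<close> positive when \<open>S = 0\<close>;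
    dividing by \<open>K\<close> moves \<open>\<psi> \<circ> S\<close> into the unit ball.\<close>
  define K where "K = norm S + 1"
  have K: "0 < K"
    by (simp add: K_def add_nonneg_pos)
  define g where "g = (\<lambda>\<psi> :: 'e \<Rightarrow>\<^sub>L real. (1/K) *\<^sub>R (\<psi> o\<^sub>L S))"
  have g_ball: "g \<psi> \<in> cball 0 1" if "\<psi> \<in> cball 0 1" for \<psi>
  proof -
    have "norm (\<psi> o\<^sub>L S) \<le> norm \<psi> * norm S"
      by (rule norm_blinfun_compose)
    also have "\<dots> \<le> 1 * norm S"
      using that by (intro mult_right_mono) auto
    also have "\<dots> \<le> K"
      by (simp add: K_def)
    finally show ?thesis
      using K by (simp add: g_def)
  qed
  have g_cont: "continuous_map weak_star_ball weak_star_ball g"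
  proof -
    have "continuous_map weak_star_ball weak_star g"
      unfolding continuous_on_strong_operator_topo_iff_coordinatewise g_def
      by (auto simp: blinfun.scaleR_left divide_inverse intro!: continuous_map_real_mult_left
          continuous_map_weak_star_ball_eval)
    then show ?thesis
      using g_ball by (auto simp: continuous_map_in_subtopology strong_operator_topology_topspace)
  qed
  show "fragmented_family weak_star_ball ((\<lambda>w \<psi>. blinfun_apply \<psi> w) ` ?C)"
    unfolding fragmented_family_def
  proof (intro allI impI)
    fix A :: "('e \<Rightarrow>\<^sub>L real) set" and \<epsilon> :: real
    assume A: "A \<subseteq> topspace weak_star_ball \<and> A \<noteq> {} \<and> 0 < \<epsilon>"
    \<comment> \<open>Fragmentability is applied to the image of the test set, with
      \<open>\<epsilon> / K\<close> to compensate for the scaling in \<open>g\<close>.\<close>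
    have gA: "g ` A \<subseteq> topspace weak_star_ball \<and> g ` A \<noteq> {} \<and> 0 < \<epsilon> / K"
      using A g_ball K unfolding topspace_weak_star_ball by auto
    obtain U where U: "openin weak_star_ball U" "U \<inter> g ` A \<noteq> {}"
      and bdd: "bounded (dual_op R ` (U \<inter> g ` A))"
      and diam: "diameter (dual_op R ` (U \<inter> g ` A)) < \<epsilon> / K"
      using frag[unfolded fragmented_def fragmented_family_def, rule_format, OF gA] by auto
    \<comment> \<open>Bounding by the actual diameter instead of \<open>\<epsilon> / K\<close>
      preserves the strict inequality after passing to the supremum.\<close>
    define D where "D = diameter (dual_op R ` (U \<inter> g ` A))"
    define V where "V = {\<psi> \<in> topspace weak_star_ball. g \<psi> \<in> U}"
    have V: "openin weak_star_ball V"
      unfolding V_def by (rule openin_continuous_map_preimage[OF g_cont U(1)])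
    have VA: "V \<inter> A \<noteq> {}"
      using U(2) A unfolding V_def by blast
    have close: "\<bar>blinfun_apply \<psi> (blinfun_apply S (blinfun_apply R a))
        - blinfun_apply \<theta> (blinfun_apply S (blinfun_apply R a))\<bar> \<le> K * D"
      if "\<psi> \<in> V \<inter> A" "\<theta> \<in> V \<inter> A" "a \<in> cball 0 1" for \<psi> \<theta> a
    proof -
      let ?d = "(g \<psi> o\<^sub>L R) - (g \<theta> o\<^sub>L R)"
      have "norm ?d \<le> D"
        unfolding D_def dist_norm[symmetric]
        using that by (intro diameter_bounded_bound[OF bdd]) (auto simp: V_def)
      moreover have "\<bar>blinfun_apply ?d a\<bar> \<le> norm ?d"
        using norm_blinfun[of ?d a] mult_left_mono[of "norm a" 1 "norm ?d"] that by simp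
      ultimately have "K * \<bar>blinfun_apply ?d a\<bar> \<le> K * D"
        using K by (intro mult_left_mono) auto
      moreover have "K * blinfun_apply ?d a = blinfun_apply \<psi> (blinfun_apply S (blinfun_apply R a))
          - blinfun_apply \<theta> (blinfun_apply S (blinfun_apply R a))"
        using K by (simp add: g_def blinfun.diff_left blinfun.scaleR_left field_simps)
      ultimately show ?thesis
        using K by (metis abs_mult abs_of_pos)
    qed
    show "\<exists>U. openin weak_star_ball U \<and> U \<inter> A \<noteq> {} \<and>
        (\<forall>f\<in>(\<lambda>w \<psi>. blinfun_apply \<psi> w) ` ?C. bounded (f ` (U \<inter> A)) \<and> diameter (f ` (U \<inter> A)) < \<epsilon>)"
    proof (intro exI[of _ V] conjI ballI)
      fix f :: "('e \<Rightarrow>\<^sub>L real) \<Rightarrow> real"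
      assume "f \<in> (\<lambda>w \<psi>. blinfun_apply \<psi> w) ` ?C"
      then obtain a where a: "a \<in> cball 0 1"
        and f: "f = (\<lambda>\<psi>. blinfun_apply \<psi> (blinfun_apply S (blinfun_apply R a)))"
        by auto
      have le: "norm (y - z) \<le> K * D" if "y \<in> f ` (V \<inter> A)" "z \<in> f ` (V \<inter> A)" for y z
        using that close[OF _ _ a] unfolding f by auto
      obtain y where y: "y \<in> f ` (V \<inter> A)"
        using VA by blast
      show "bounded (f ` (V \<inter> A))"
        using le[OF y] unfolding bounded_def dist_norm by blast
      have "diameter (f ` (V \<inter> A)) \<le> K * D"
        using VA le by (intro diameter_le) auto
      also have "\<dots> < \<epsilon>"
        using diam K by (simp add: D_def field_simps)
      finally show "diameter (f ` (V \<inter> A)) < \<epsilon>" .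
    qed (use V VA in auto)
  qed
qed

text \<open>
  The weak-star closure of the test set is compact, hence a Baire space, and by separability it is
  covered by countably many preimages of small closed balls, which are weak-star closed; one of
  them has interior.
\<close>

lemma dual_op_fragmented_if_separable:
  fixes R :: "'a::real_normed_vector \<Rightarrow>\<^sub>L 'w::real_normed_vector"
  assumes sep: "separable_space (top_of_set (dual_op R ` cball 0 1))"
  shows "fragmented weak_star_ball (dual_op R)"
  unfolding fragmented_def fragmented_family_def
proof (intro allI impI)
  let ?X = "weak_star_ball :: ('w \<Rightarrow>\<^sub>L real) topology"
  fix A :: "('w \<Rightarrow>\<^sub>L real) set" and \<epsilon> :: real
  assume A: "A \<subseteq> topspace ?X \<and> A \<noteq> {} \<and> 0 < \<epsilon>"
  obtain D where D: "countable D"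
    "top_of_set (dual_op R ` cball 0 1) closure_of D = dual_op R ` cball 0 1"
    using sep unfolding separable_space_def by auto
  have dense: "\<exists>d\<in>D. norm ((\<omega> o\<^sub>L R) - d) \<le> \<epsilon> / 4" if "\<omega> \<in> cball 0 1" for \<omega>
  proof -
    have "\<omega> o\<^sub>L R \<in> closure D"
      using D(2) that closure_of_subtopology_subset[of euclidean _ D] by fastforce
    then obtain d where "d \<in> D" "dist d (\<omega> o\<^sub>L R) < \<epsilon> / 4"
      using A by (meson closure_approachable zero_less_divide_iff zero_less_numeral)
    then show ?thesis
      by (intro bexI[of _ d]) (simp_all add: dist_norm norm_minus_commute)
  qed
  define E where "E = ?X closure_of A"
  define Y where "Y = subtopology ?X E"
  define G where "G = (\<lambda>d. {\<omega> \<in> E. norm ((\<omega> o\<^sub>L R) - d) \<le> \<epsilon> / 4})"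
  have E_ball: "E \<subseteq> cball 0 1"
    using closure_of_subset_topspace[of ?X A] by (simp add: E_def topspace_weak_star_ball)
  have A_E: "A \<subseteq> E"
    unfolding E_def using A by (intro closure_of_subset) auto
  have top_Y: "topspace Y = E"
    using E_ball by (auto simp: Y_def strong_operator_topology_topspace)
  have "compact_space Y"
    unfolding Y_def E_def
    by (intro compact_space_subtopology closedin_compact_space[OF banach_alaoglu]) simp
  moreover have "Hausdorff_space Y"
    unfolding Y_def by (intro Hausdorff_space_subtopology Hausdorff_weak_star)
  ultimately have Baire: "locally_compact_space Y \<and> regular_space Y"
    by (simp add: compact_imp_locally_compact_space compact_Hausdorff_imp_regular_space)
  have G_closed: "closedin Y (G d)" for d
  proof -
    \<comment> \<open>The norm inequality is split into conditions on the single evaluations of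
      \<open>\<omega>\<close>; each is weak-star closed, hence so is their intersection.\<close>
    have "norm ((\<omega> o\<^sub>L R) - d) \<le> \<epsilon> / 4 \<longleftrightarrow>
        (\<forall>b. \<bar>blinfun_apply \<omega> (blinfun_apply R b) - blinfun_apply d b\<bar> \<le> \<epsilon> / 4 * norm b)" for \<omega>
    proof
      assume le: "norm ((\<omega> o\<^sub>L R) - d) \<le> \<epsilon> / 4"
      show "\<forall>b. \<bar>blinfun_apply \<omega> (blinfun_apply R b) - blinfun_apply d b\<bar> \<le> \<epsilon> / 4 * norm b"
      proof
        fix b
        show "\<bar>blinfun_apply \<omega> (blinfun_apply R b) - blinfun_apply d b\<bar> \<le> \<epsilon> / 4 * norm b"
          using norm_blinfun[of "(\<omega> o\<^sub>L R) - d" b] mult_right_mono[OF le, of "norm b"]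
          by (simp add: blinfun.diff_left)
      qed
    next
      assume "\<forall>b. \<bar>blinfun_apply \<omega> (blinfun_apply R b) - blinfun_apply d b\<bar> \<le> \<epsilon> / 4 * norm b"
      then show "norm ((\<omega> o\<^sub>L R) - d) \<le> \<epsilon> / 4"
        using A by (intro norm_blinfun_bound) (auto simp: blinfun.diff_left)
    qed
    then have G_eq: "G d = (\<Inter>b. {\<omega> \<in> topspace Y.
        blinfun_apply \<omega> (blinfun_apply R b) \<in> cball (blinfun_apply d b) (\<epsilon> / 4 * norm b)})"
      by (auto simp: G_def top_Y dist_real_def abs_minus_commute)
    have "continuous_map Y euclideanreal (\<lambda>\<omega>. blinfun_apply \<omega> w)" for w
      unfolding Y_def
      by (rule continuous_map_from_subtopology) (rule continuous_map_weak_star_ball_eval)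
    then have "closedin Y {\<omega> \<in> topspace Y.
        blinfun_apply \<omega> (blinfun_apply R b) \<in> cball (blinfun_apply d b) (\<epsilon> / 4 * norm b)}" for b
      by (rule closedin_continuous_map_preimage) simp
    then show ?thesis
      unfolding G_eq by blast
  qed
  have "\<Union>(G ` D) = E"
    using dense E_ball by (auto simp: G_def)
  then have "Y interior_of \<Union>(G ` D) \<noteq> {}"
    using A A_E interior_of_topspace[of Y] top_Y by auto
  then have "\<exists>T\<in>G ` D. Y interior_of T \<noteq> {}"
    using Baire_category_alt[OF disjI2[OF Baire] countable_image[OF D(1)], of G] G_closed by auto
  then obtain d where "Y interior_of G d \<noteq> {}"
    by blast
  then obtain W where "openin Y W" "W \<subseteq> G d" "W \<noteq> {}"
    by (metis openin_interior_of interior_of_subset)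
  then obtain U where U: "openin ?X U" "U \<inter> E \<subseteq> G d" "U \<inter> E \<noteq> {}"
    unfolding Y_def openin_subtopology by blast
  \<comment> \<open>An open set that meets the closure of \<open>A\<close> meets \<open>A\<close>,
    which leads from \<open>E\<close> back to the test set.\<close>
  have UA: "U \<inter> A \<noteq> {}"
    using U(1,3) openin_Int_closure_of_eq_empty[OF U(1), of A] by (simp add: E_def)
  \<comment> \<open>Radius \<open>\<epsilon> / 4\<close> bounds the diameter by
    \<open>\<epsilon> / 2\<close>, strictly below \<open>\<epsilon>\<close>.\<close>
  have le: "norm (y - z) \<le> \<epsilon> / 2"
    if yz: "y \<in> dual_op R ` (U \<inter> A)" "z \<in> dual_op R ` (U \<inter> A)" for y z
  proof -
    have "norm (y - d) \<le> \<epsilon> / 4" "norm (z - d) \<le> \<epsilon> / 4"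
      using yz U(2) A_E by (auto simp: G_def)
    then show ?thesis
      using norm_triangle_ineq4[of "y - d" "z - d"] by simp
  qed
  obtain y where y: "y \<in> dual_op R ` (U \<inter> A)"
    using UA by blast
  have "bounded (dual_op R ` (U \<inter> A))"
    using le[OF y] unfolding bounded_def dist_norm by blast
  moreover have "diameter (dual_op R ` (U \<inter> A)) < \<epsilon>"
  proof -
    have "diameter (dual_op R ` (U \<inter> A)) \<le> \<epsilon> / 2"
      using UA le by (intro diameter_le) auto
    then show ?thesis
      using A by simp
  qed
  ultimately show "\<exists>U. openin ?X U \<and> U \<inter> A \<noteq> {} \<and>
      (\<forall>f\<in>{dual_op R}. bounded (f ` (U \<inter> A)) \<and> diameter (f ` (U \<inter> A)) < \<epsilon>)"
    using U(1) UA by blast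
qed

text \<open>An l1-sequence in the image lifts to a sequence \<open>w\<close> in the unit ball.
  Interpolating functionals \<open>\<psi>\<close> on it, composed with \<open>S\<close> and
  rescaled, witness that \<open>w\<close> is independent over the dual image.\<close>

lemma tame_subset_if_dual_op_co_tame:
  fixes R :: "'a::banach \<Rightarrow>\<^sub>L 'w::real_normed_vector"
    and S :: "'w \<Rightarrow>\<^sub>L 'e::banach"
  assumes cot: "co_tame (dual_op R ` cball 0 1)"
  shows "tame_subset ((\<lambda>a. blinfun_apply S (blinfun_apply R a)) ` cball 0 1)"
  unfolding tame_subset_def
proof (intro conjI notI)
  let ?SR = "\<lambda>a. blinfun_apply S (blinfun_apply R a)"
  let ?M = "dual_op R ` cball 0 1"
  show "bounded (?SR ` cball 0 1)"
    using bounded_linear_image[OF bounded_cball, of ?SR 0 1]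
    by (simp add: bounded_linear_compose blinfun.bounded_linear_right)
  assume "\<exists>f. range f \<subseteq> ?SR ` cball 0 1 \<and> l1_sequence f"
  then obtain f where f: "range f \<subseteq> ?SR ` cball 0 1" and "l1_sequence f"
    by blast
  then obtain \<delta> where \<delta>: "0 < \<delta>"
    and l1: "\<And>n (c :: nat \<Rightarrow> real). \<delta> * (\<Sum>i<n. \<bar>c i\<bar>) \<le> norm (\<Sum>i<n. c i *\<^sub>R f i)"
    unfolding l1_sequence_def by blast
  have "\<forall>n. \<exists>a. a \<in> cball 0 1 \<and> f n = ?SR a"
    using f by blast
  then obtain w where w: "\<And>n. w n \<in> cball 0 1" and fw: "\<And>n. f n = ?SR (w n)"
    by metis
  define K where "K = norm S + 1"
  have K: "0 < K"
    by (simp add: K_def add_nonneg_pos)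
  have "independent_over ?M (\<lambda>n \<psi>. blinfun_apply \<psi> (w n))"
    unfolding independent_over_def
  proof (intro conjI exI allI impI ballI)
    fix n \<psi>
    assume "\<psi> \<in> ?M"
    then obtain \<omega> where \<omega>: "norm \<omega> \<le> 1" "\<psi> = \<omega> o\<^sub>L R"
      by auto
    have "norm \<psi> \<le> norm \<omega> * norm R"
      unfolding \<omega>(2) by (rule norm_blinfun_compose)
    also have "\<dots> \<le> 1 * norm R"
      using \<omega>(1) by (intro mult_right_mono) auto
    finally have "norm \<psi> \<le> norm R" by simp
    moreover have "\<bar>blinfun_apply \<psi> (w n)\<bar> \<le> norm \<psi>"
      using norm_blinfun[of \<psi> "w n"] mult_left_mono[of "norm (w n)" 1 "norm \<psi>"] w[of n] by simp
    ultimately show "\<bar>blinfun_apply \<psi> (w n)\<bar> \<le> norm R" by simp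
  next
    \<comment> \<open>The thresholds are the interpolated values \<open>\<delta>\<close> and
      \<open>- \<delta>\<close> after the division by \<open>K\<close> that brings
      \<open>\<psi> \<circ> S\<close> into the unit ball.\<close>
    show "- (\<delta> / K) < \<delta> / K"
      using \<delta> K by simp
  next
    fix N M :: "nat set"
    assume NM: "finite N \<and> finite M \<and> N \<inter> M = {}"
    \<comment> \<open>The default \<open>- \<delta>\<close> off \<open>M\<close> covers
      \<open>N\<close>, which is disjoint from \<open>M\<close>.\<close>
    define s where "s = (\<lambda>n. if n \<in> M then \<delta> else - \<delta>)"
    obtain \<psi> :: "'e \<Rightarrow>\<^sub>L real" where \<psi>: "norm \<psi> \<le> 1" "\<And>n. blinfun_apply \<psi> (f n) = s n"
      using \<delta> by (rule_tac s = s in l1_sequence_interpolation[OF l1]) (auto simp: s_def)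
    define \<omega> where "\<omega> = (1/K) *\<^sub>R (\<psi> o\<^sub>L S)"
    have "norm (\<psi> o\<^sub>L S) \<le> norm \<psi> * norm S"
      by (rule norm_blinfun_compose)
    also have "\<dots> \<le> 1 * norm S"
      using \<psi>(1) by (intro mult_right_mono) auto
    also have "\<dots> \<le> K"
      by (simp add: K_def)
    finally have "\<omega> \<in> cball 0 1"
      using K by (simp add: \<omega>_def)
    moreover have "blinfun_apply (\<omega> o\<^sub>L R) (w n) = s n / K" for n
      using \<psi>(2)[of n] by (simp add: \<omega>_def fw blinfun.scaleR_left)
    ultimately show "\<exists>\<psi>\<in>?M. (\<forall>n\<in>N. blinfun_apply \<psi> (w n) \<le> - (\<delta> / K)) \<and>
        (\<forall>m\<in>M. \<delta> / K \<le> blinfun_apply \<psi> (w m))"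
      using NM by (intro bexI[of _ "\<omega> o\<^sub>L R"]) (auto simp: s_def)
  qed
  with cot w show False
    unfolding co_tame_def by blast
qed

section \<open>Factorisation of the two orbits of a matrix coefficient\<close>

text \<open>Multiplicativity of \<open>\<iota>\<close> turns
  \<open>\<langle>\<phi>, (a b) x\<rangle>\<close> into
  \<open>\<langle>\<phi> \<cdot> a, b x\<rangle>\<close>. So \<open>R\<close> is
  \<open>a \<mapsto> \<phi> \<cdot> a\<close>, and \<open>S\<close> is the dual operator of
  \<open>T\<close>, the map \<open>b \<mapsto> b x\<close>.\<close>

lemma right_circ_factorisation:
  fixes \<iota> :: "'a::{banach,real_normed_algebra} \<Rightarrow>\<^sub>L ('v::banach \<Rightarrow>\<^sub>L 'v)"
  assumes "banach_subalgebra \<iota>"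
  obtains R :: "'a \<Rightarrow>\<^sub>L ('v \<Rightarrow>\<^sub>L real)" and S :: "('v \<Rightarrow>\<^sub>L real) \<Rightarrow>\<^sub>L ('a \<Rightarrow>\<^sub>L real)"
  where "orbit_left \<iota> \<phi> = dual_op R"
    and "(\<lambda>a. matrix_coefficient \<iota> x \<phi> \<circledast>\<^sub>r a) = (\<lambda>a. blinfun_apply S (blinfun_apply R a))"
proof -
  define R where "R = Blinfun (functional_act \<iota> \<phi>)"
  define T where "T = Blinfun (\<lambda>b. blinfun_apply (blinfun_apply \<iota> b) x)"
  define S where "S = Blinfun (\<lambda>\<theta> :: 'v \<Rightarrow>\<^sub>L real. \<theta> o\<^sub>L T)"
  have R: "blinfun_apply R a = \<phi> o\<^sub>L blinfun_apply \<iota> a" for a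
    unfolding R_def functional_act_def
    by (subst bounded_linear_Blinfun_apply)
      (auto intro!: bounded_linear_compose[OF bounded_bilinear.bounded_linear_right[OF
          bounded_bilinear_blinfun_compose]] blinfun.bounded_linear_right)
  have T: "blinfun_apply T b = blinfun_apply (blinfun_apply \<iota> b) x" for b
    unfolding T_def
    by (subst bounded_linear_Blinfun_apply)
      (auto intro!: bounded_linear_compose[OF blinfun.bounded_linear_left]
        blinfun.bounded_linear_right)
  have S: "blinfun_apply S \<theta> = \<theta> o\<^sub>L T" for \<theta>
    unfolding S_def
    by (subst bounded_linear_Blinfun_apply)
      (auto intro!: bounded_bilinear.bounded_linear_left[OF bounded_bilinear_blinfun_compose])
  show ?thesis
  proof (rule that[of R S])
    show "orbit_left \<iota> \<phi> = dual_op R"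
      by (intro ext blinfun_eqI) (simp add: orbit_left_apply functional_act_def R)
    show "(\<lambda>a. matrix_coefficient \<iota> x \<phi> \<circledast>\<^sub>r a) = (\<lambda>a. blinfun_apply S (blinfun_apply R a))"
      using assms
      by (intro ext blinfun_eqI)
        (simp add: right_circ_apply matrix_coefficient_apply R S T banach_subalgebra_def)
  qed
qed

text \<open>Here \<open>\<langle>\<phi>, (b a) x\<rangle> = \<langle>\<phi>, b (a
  x)\<rangle>\<close> is the matrix coefficient at the vector \<open>a x\<close>, so
  \<open>S\<close> sends \<open>y\<close> to the coefficient of \<open>y\<close> and
  \<open>\<phi>\<close>.\<close>

lemma left_circ_factorisation:
  fixes \<iota> :: "'a::{banach,real_normed_algebra} \<Rightarrow>\<^sub>L ('v::banach \<Rightarrow>\<^sub>L 'v)"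
  assumes "banach_subalgebra \<iota>"
  obtains R :: "'a \<Rightarrow>\<^sub>L 'v" and S :: "'v \<Rightarrow>\<^sub>L ('a \<Rightarrow>\<^sub>L real)"
  where "orbit_right \<iota> x = dual_op R"
    and "(\<lambda>a. a \<circledast>\<^sub>l matrix_coefficient \<iota> x \<phi>) = (\<lambda>a. blinfun_apply S (blinfun_apply R a))"
proof -
  define R where "R = Blinfun (\<lambda>b. blinfun_apply (blinfun_apply \<iota> b) x)"
  define S where "S = Blinfun (\<lambda>y. matrix_coefficient \<iota> y \<phi>)"
  have R: "blinfun_apply R b = blinfun_apply (blinfun_apply \<iota> b) x" for b
    unfolding R_def
    by (subst bounded_linear_Blinfun_apply)
      (auto intro!: bounded_linear_compose[OF blinfun.bounded_linear_left]
        blinfun.bounded_linear_right)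
  have "bounded_linear (\<lambda>y. matrix_coefficient \<iota> y \<phi>)"
  proof (rule bounded_linear_intro[where K = "norm \<phi> * norm \<iota>"])
    fix y
    show "norm (matrix_coefficient \<iota> y \<phi>) \<le> norm y * (norm \<phi> * norm \<iota>)"
    proof (rule norm_blinfun_bound)
      fix b
      have "\<bar>blinfun_apply \<phi> (blinfun_apply (blinfun_apply \<iota> b) y)\<bar>
          \<le> norm \<phi> * norm (blinfun_apply (blinfun_apply \<iota> b) y)"
        using norm_blinfun[of \<phi>] by simp
      also have "\<dots> \<le> norm \<phi> * (norm (blinfun_apply \<iota> b) * norm y)"
        by (intro mult_left_mono norm_blinfun) simp
      also have "\<dots> \<le> norm \<phi> * ((norm \<iota> * norm b) * norm y)"
        by (intro mult_left_mono mult_right_mono norm_blinfun) simp_all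
      finally show "norm (blinfun_apply (matrix_coefficient \<iota> y \<phi>) b)
          \<le> norm y * (norm \<phi> * norm \<iota>) * norm b"
        by (simp add: matrix_coefficient_apply mult_ac)
    qed simp
  qed (auto intro!: blinfun_eqI
      simp: matrix_coefficient_apply blinfun.add_left blinfun.add_right
        blinfun.scaleR_left blinfun.scaleR_right)
  then have S: "blinfun_apply S y = matrix_coefficient \<iota> y \<phi>" for y
    by (simp add: S_def bounded_linear_Blinfun_apply)
  show ?thesis
  proof (rule that[of R S])
    show "orbit_right \<iota> x = dual_op R"
      by (intro ext blinfun_eqI) (simp add: orbit_right_apply R)
    show "(\<lambda>a. a \<circledast>\<^sub>l matrix_coefficient \<iota> x \<phi>) = (\<lambda>a. blinfun_apply S (blinfun_apply R a))"
      using assms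
      by (intro ext blinfun_eqI)
        (simp add: left_circ_apply matrix_coefficient_apply R S banach_subalgebra_def)
  qed
qed

theorem proposition5p3:
  fixes \<iota> :: "'a::{banach,real_normed_algebra} \<Rightarrow>\<^sub>L ('v::banach \<Rightarrow>\<^sub>L 'v)"
    and x :: 'v
    and \<phi> :: "'v \<Rightarrow>\<^sub>L real"
  assumes "banach_subalgebra \<iota>"
  shows
    "(fragmented weak_star_ball (orbit_left \<iota> \<phi>) \<longrightarrow>
        right_asplund (matrix_coefficient \<iota> x \<phi>)) \<and>
     (fragmented weak_star_ball (orbit_right \<iota> x) \<longrightarrow>
        left_asplund (matrix_coefficient \<iota> x \<phi>)) \<and>
     ((separable_space (top_of_set (orbit_left \<iota> \<phi> ` cball 0 1)) \<longrightarrow>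
         right_asplund (matrix_coefficient \<iota> x \<phi>)) \<and>
      (co_tame (orbit_left \<iota> \<phi> ` cball 0 1) \<longrightarrow>
         right_tame (matrix_coefficient \<iota> x \<phi>))) \<and>
     ((separable_space (top_of_set (orbit_right \<iota> x ` cball 0 1)) \<longrightarrow>
         left_asplund (matrix_coefficient \<iota> x \<phi>)) \<and>
      (co_tame (orbit_right \<iota> x ` cball 0 1) \<longrightarrow>
         left_tame (matrix_coefficient \<iota> x \<phi>)))"
proof -
  obtain R :: "'a \<Rightarrow>\<^sub>L ('v \<Rightarrow>\<^sub>L real)" and S :: "('v \<Rightarrow>\<^sub>L real) \<Rightarrow>\<^sub>L ('a \<Rightarrow>\<^sub>L real)"
    where right: "orbit_left \<iota> \<phi> = dual_op R"
      "(\<lambda>a. matrix_coefficient \<iota> x \<phi> \<circledast>\<^sub>r a) = (\<lambda>a. blinfun_apply S (blinfun_apply R a))"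
    using right_circ_factorisation[OF assms] .
  obtain R' :: "'a \<Rightarrow>\<^sub>L 'v" and S' :: "'v \<Rightarrow>\<^sub>L ('a \<Rightarrow>\<^sub>L real)"
    where left: "orbit_right \<iota> x = dual_op R'"
      "(\<lambda>a. a \<circledast>\<^sub>l matrix_coefficient \<iota> x \<phi>) = (\<lambda>a. blinfun_apply S' (blinfun_apply R' a))"
    using left_circ_factorisation[OF assms] .
  \<comment> \<open>With both orbits in the form \<open>S \<circ> R\<close>, each of the six
    implications is an instance of the general results on dual operators; the separable cases pass
    through fragmentability.\<close>
  show ?thesis
    unfolding right_asplund_def left_asplund_def right_tame_def left_tame_def right left
    by (intro conjI impI)
      (erule asplund_subset_if_dual_op_fragmented tame_subset_if_dual_op_co_tame
        asplund_subset_if_dual_op_fragmented[OF dual_op_fragmented_if_separable])+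
qed

end
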